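(* Let $A,B,C$ be a Leonard triple on $V$ that has $q$-Racah type with Huang data $(a,b,c,d)$, and let $W,W',W'',\overline A,\overline B,\overline C\in\mathrm{End}(V)$ be as defined in the context. Then: Conjugation by $W^{\pm1}$: $W^{-1}AW=A$, $\;W^{-1}BW=C+\overline A$, $\;W^{-1}CW=B+\frac{CA-AC}{q-q^{-1}}-\overline A$; and $WAW^{-1}=A$, $\;WBW^{-1}=C+\frac{AB-BA}{q-q^{-1}}+\overline A$, $\;WCW^{-1}=B-\overline A$. Conjugation by $(W')^{\pm1}$: $(W')^{-1}AW'=C+\frac{AB-BA}{q-q^{-1}}-\overline B$, $\;(W')^{-1}BW'=B$, $\;(W')^{-1}CW'=A+\overline B$; and $W'A(W')^{-1}=C-\overline B$, $\;W'B(W')^{-1}=B$, $\;W'C(W')^{-1}=A+\frac{BC-CB}{q-q^{-1}}+\overline B$. Conjugation by $(W'')^{\pm1}$: $(W'')^{-1}AW''=B+\overline C$, $\;(W'')^{-1}BW''=A+\frac{BC-CB}{q-q^{-1}}-\overline C$, $\;(W'')^{-1}CW''=C$; and $W''A(W'')^{-1}=B+\frac{CA-AC}{q-q^{-1}}+\overline C$, $\;W''B(W'')^{-1}=A-\overline C$, $\;W''C(W'')^{-1}=C$.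
   Context: Let $\mathbb F$ be a field, $d\ge 0$ an integer, $V$ a vector space over $\mathbb F$ of dimension $d+1$, $\mathrm{End}(V)$ the $\mathbb F$-algebra of $\mathbb F$-linear maps $V\to V$, and $I$ its identity. A square matrix is tridiagonal if each nonzero entry lies on the diagonal, subdiagonal or superdiagonal; a tridiagonal matrix is irreducible if every subdiagonal entry and every superdiagonal entry is nonzero. Leonard triple on $V$: a 3-tuple $A,B,C$ of elements of $\mathrm{End}(V)$ such that (i) there is a basis of $V$ with respect to which $A$ is represented by a diagonal matrix and $B,C$ by irreducible tridiagonal matrices; (ii) there is a basis with respect to which $B$ is diagonal and $C,A$ are irreducible tridiagonal; (iii) there is a basis with respect to which $C$ is diagonal and $A,B$ are irreducible tridiagonal. Each of $A,B,C$ is then diagonalizable with one-dimensional eigenspaces. An ordering of the eigenvalues of $A$ is standard if corresponding eigenvectors, in that order, form a basis as in (i); similarly for $B$ with (ii) and $C$ with (iii). Standing assumptions: fix a nonzero $q\in\mathbb F$ with $q^4\ne 1$ and nonzero $a,b,c\in\mathbb F$ such that $q^{2i}\ne 1$ for $1\le i\le d$; none of $a^2,b^2,c^2$ is among $q^{2d-2},q^{2d-4},\ldots,q^{2-2d}$; none of $abc,a^{-1}bc,ab^{-1}c,abc^{-1}$ is among $q^{d-1},q^{d-3},\ldots,q^{1-d}$. For $0\le i\le d$ let $\theta_i=aq^{2i-d}+a^{-1}q^{d-2i}$, $\theta'_i=bq^{2i-d}+b^{-1}q^{d-2i}$, $\theta''_i=cq^{2i-d}+c^{-1}q^{d-2i}$.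 A Leonard triple $A,B,C$ on $V$ has $q$-Racah type with Huang data $(a,b,c,d)$ if $\{\theta_i\}_{i=0}^d$, $\{\theta'_i\}_{i=0}^d$, $\{\theta''_i\}_{i=0}^d$ are standard orderings of the eigenvalues of $A$, $B$, $C$ respectively, and $$A+\frac{qBC-q^{-1}CB}{q^2-q^{-2}}=\alpha_a I,\quad B+\frac{qCA-q^{-1}AC}{q^2-q^{-2}}=\alpha_b I,\quad C+\frac{qAB-q^{-1}BA}{q^2-q^{-2}}=\alpha_c I,$$ where $\alpha_a=\frac{(a+a^{-1})(q^{d+1}+q^{-d-1})+(b+b^{-1})(c+c^{-1})}{q+q^{-1}}$, $\alpha_b=\frac{(b+b^{-1})(q^{d+1}+q^{-d-1})+(c+c^{-1})(a+a^{-1})}{q+q^{-1}}$, $\alpha_c=\frac{(c+c^{-1})(q^{d+1}+q^{-d-1})+(a+a^{-1})(b+b^{-1})}{q+q^{-1}}$. For $0\le i\le d$ let $E_i$ (resp. $E'_i$, $E''_i$) be the primitive idempotent of $A$ (resp. $B$, $C$) for $\theta_i$ (resp. $\theta'_i$, $\theta''_i$): the projection of $V$ onto that eigenspace that is zero on the other eigenspaces. Define $$W=\sum_{i=0}^d(-1)^ia^{-i}q^{i(d-i)}E_i,\quad W'=\sum_{i=0}^d(-1)^ib^{-i}q^{i(d-i)}E'_i,\quad W''=\sum_{i=0}^d(-1)^ic^{-i}q^{i(d-i)}E''_i,$$ which are invertible, and $$\overline A=W^{-1}BW-C,\quad \overline B=(W')^{-1}CW'-A,\quad \overline C=(W'')^{-1}AW''-B.$$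 *)

theory Defs
  imports
    "HOL-Library.Function_Algebras"
    "Jordan_Normal_Form.Matrix"
begin

text \<open>
  The group inverse of HOL-Algebra hides \<open>inv\<close> for functions.
\<close>

unbundle no m_inv_syntax

text \<open>
  The vector space \<open>V\<close> is the whole type \<open>'b\<close> with scalar multiplication \<open>scale\<close>, and \<open>End(V)\<close>
  consists of the functions \<open>X\<close> with \<open>Vector_Spaces.linear scale scale X\<close>. The ring operations of
  \<open>End(V)\<close> are pointwise addition and subtraction (instances from Function_Algebras), composition,
  and \<open>scale k \<circ> X\<close> for the scalar multiple \<open>k X\<close>. The multiplication on functions provided by
  Function_Algebras is pointwise and is not used.
\<close>

definition tridiagonal_mat :: "'a::zero mat \<Rightarrow> bool" where
  "tridiagonal_mat M \<longleftrightarrow> square_mat M \<and>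
     (\<forall>i<dim_row M. \<forall>j<dim_row M. M $$ (i, j) \<noteq> 0 \<longrightarrow> i = j \<or> i = Suc j \<or> j = Suc i)"

definition irreducible_tridiagonal_mat :: "'a::zero mat \<Rightarrow> bool" where
  "irreducible_tridiagonal_mat M \<longleftrightarrow> tridiagonal_mat M \<and>
     (\<forall>i. Suc i < dim_row M \<longrightarrow> M $$ (Suc i, i) \<noteq> 0 \<and> M $$ (i, Suc i) \<noteq> 0)"

text \<open>
  A vector space of dimension \<open>d + 1\<close>; since \<open>dim\<close> is \<open>0\<close> on infinite-dimensional spaces, the
  assumption includes finite-dimensionality.
\<close>

locale leonard_space = vector_space scale
  for scale :: "'a::field \<Rightarrow> 'b::ab_group_add \<Rightarrow> 'b" (infixr "*s" 75) +
  fixes d :: nat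
  assumes dim_space: "dim (UNIV :: 'b set) = d + 1"
begin

definition ordered_basis :: "(nat \<Rightarrow> 'b) \<Rightarrow> bool" where
  "ordered_basis v \<longleftrightarrow>
     inj_on v {..d} \<and> independent (v ` {..d}) \<and> span (v ` {..d}) = UNIV"

text \<open>Column \<open>j\<close> holds the coordinates of \<open>X (v j)\<close>.\<close>

definition matrix_of :: "(nat \<Rightarrow> 'b) \<Rightarrow> ('b \<Rightarrow> 'b) \<Rightarrow> 'a mat" where
  "matrix_of v X =
     mat (Suc d) (Suc d) (\<lambda>(i, j). representation (v ` {..d}) (X (v j)) (v i))"

definition leonard_basis ::
    "('b \<Rightarrow> 'b) \<Rightarrow> ('b \<Rightarrow> 'b) \<Rightarrow> ('b \<Rightarrow> 'b) \<Rightarrow> (nat \<Rightarrow> 'b) \<Rightarrow> bool" where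
  "leonard_basis X Y Z v \<longleftrightarrow> ordered_basis v \<and>
     diagonal_mat (matrix_of v X) \<and>
     irreducible_tridiagonal_mat (matrix_of v Y) \<and>
     irreducible_tridiagonal_mat (matrix_of v Z)"

definition leonard_triple ::
    "('b \<Rightarrow> 'b) \<Rightarrow> ('b \<Rightarrow> 'b) \<Rightarrow> ('b \<Rightarrow> 'b) \<Rightarrow> bool" where
  "leonard_triple A B C \<longleftrightarrow>
     Vector_Spaces.linear scale scale A \<and>
     Vector_Spaces.linear scale scale B \<and>
     Vector_Spaces.linear scale scale C \<and>
     (\<exists>v. leonard_basis A B C v) \<and>
     (\<exists>v. leonard_basis B C A v) \<and>
     (\<exists>v. leonard_basis C A B v)"

definition eigenspace :: "('b \<Rightarrow> 'b) \<Rightarrow> 'a \<Rightarrow> 'b set" where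
  "eigenspace X \<mu> = {v. X v = \<mu> *s v}"

definition eigenvalues :: "('b \<Rightarrow> 'b) \<Rightarrow> 'a set" where
  "eigenvalues X = {\<mu>. \<exists>v \<in> eigenspace X \<mu>. v \<noteq> 0}"

definition standard_ordering ::
    "('b \<Rightarrow> 'b) \<Rightarrow> ('b \<Rightarrow> 'b) \<Rightarrow> ('b \<Rightarrow> 'b) \<Rightarrow> (nat \<Rightarrow> 'a) \<Rightarrow> bool" where
  "standard_ordering X Y Z \<theta> \<longleftrightarrow>
     bij_betw \<theta> {..d} (eigenvalues X) \<and>
     (\<exists>v. leonard_basis X Y Z v \<and> (\<forall>i\<le>d. v i \<in> eigenspace X (\<theta> i)))"

text \<open>
  The description below determines \<open>E\<close> uniquely when \<open>X\<close> is diagonalizable, which is the only case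
  of interest.
\<close>

definition primitive_idempotent :: "('b \<Rightarrow> 'b) \<Rightarrow> 'a \<Rightarrow> 'b \<Rightarrow> 'b" where
  "primitive_idempotent X \<theta> = (THE E. Vector_Spaces.linear scale scale E \<and>
     range E = eigenspace X \<theta> \<and>
     (\<forall>v \<in> eigenspace X \<theta>. E v = v) \<and>
     (\<forall>\<mu>. \<mu> \<noteq> \<theta> \<longrightarrow> (\<forall>v \<in> eigenspace X \<mu>. E v = 0)))"

end

definition racah_eigenvalue :: "'a::field \<Rightarrow> nat \<Rightarrow> 'a \<Rightarrow> nat \<Rightarrow> 'a" where
  "racah_eigenvalue q d a i =
     a * q powi (2 * int i - int d) + inverse a * q powi (int d - 2 * int i)"

text \<open>
  For \<open>d = 0\<close> the two families of excluded powers of \<open>q\<close> are empty.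
\<close>

definition racah_parameters :: "'a::field \<Rightarrow> 'a \<Rightarrow> 'a \<Rightarrow> 'a \<Rightarrow> nat \<Rightarrow> bool" where
  "racah_parameters q a b c d \<longleftrightarrow>
     q \<noteq> 0 \<and> q ^ 4 \<noteq> 1 \<and> a \<noteq> 0 \<and> b \<noteq> 0 \<and> c \<noteq> 0 \<and>
     (\<forall>i\<in>{1..d}. q ^ (2 * i) \<noteq> 1) \<and>
     (\<forall>x\<in>{a, b, c}. x\<^sup>2 \<notin> {q powi (2 * k) | k. 1 - int d \<le> k \<and> k \<le> int d - 1}) \<and>
     (\<forall>y\<in>{a * b * c, inverse a * b * c, a * inverse b * c, a * b * inverse c}.
        y \<notin> {q powi (int d - 1 - 2 * int k) | k. k < d})"

text \<open>
  \<open>\<alpha>\<^sub>a\<close>, \<open>\<alpha>\<^sub>b\<close>, \<open>\<alpha>\<^sub>c\<close> are obtained by passing \<open>(a, b, c)\<close>, \<open>(b, c, a)\<close>, \<open>(c, a, b)\<close> respectively.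
\<close>

definition racah_alpha :: "'a::field \<Rightarrow> nat \<Rightarrow> 'a \<Rightarrow> 'a \<Rightarrow> 'a \<Rightarrow> 'a" where
  "racah_alpha q d a b c =
     ((a + inverse a) * (q ^ (d + 1) + q powi (- int d - 1)) +
      (b + inverse b) * (c + inverse c)) / (q + inverse q)"

context leonard_space
begin

definition racah_relation ::
    "'a \<Rightarrow> ('b \<Rightarrow> 'b) \<Rightarrow> ('b \<Rightarrow> 'b) \<Rightarrow> ('b \<Rightarrow> 'b) \<Rightarrow> 'a \<Rightarrow> bool" where
  "racah_relation q X Y Z \<alpha> \<longleftrightarrow>
     X + (scale (1 / (q\<^sup>2 - q powi (-2))) \<circ>
            ((scale q \<circ> (Y \<circ> Z)) - (scale (inverse q) \<circ> (Z \<circ> Y))))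
       = scale \<alpha> \<circ> id"

definition racah_leonard_triple ::
    "'a \<Rightarrow> 'a \<Rightarrow> 'a \<Rightarrow> 'a \<Rightarrow> ('b \<Rightarrow> 'b) \<Rightarrow> ('b \<Rightarrow> 'b) \<Rightarrow> ('b \<Rightarrow> 'b) \<Rightarrow> bool" where
  "racah_leonard_triple q a b c A B C \<longleftrightarrow>
     leonard_triple A B C \<and>
     standard_ordering A B C (racah_eigenvalue q d a) \<and>
     standard_ordering B C A (racah_eigenvalue q d b) \<and>
     standard_ordering C A B (racah_eigenvalue q d c) \<and>
     racah_relation q A B C (racah_alpha q d a b c) \<and>
     racah_relation q B C A (racah_alpha q d b c a) \<and>
     racah_relation q C A B (racah_alpha q d c a b)"

text \<open>
  \<open>W\<close>, \<open>W'\<close>, \<open>W''\<close> are the values at \<open>(a, A)\<close>, \<open>(b, B)\<close>, \<open>(c, C)\<close>; the natural-number subtraction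
  \<open>d - i\<close> does not truncate since \<open>i \<le> d\<close>.
\<close>

definition racah_W :: "'a \<Rightarrow> 'a \<Rightarrow> ('b \<Rightarrow> 'b) \<Rightarrow> 'b \<Rightarrow> 'b" where
  "racah_W q a X =
     (\<Sum>i\<le>d. scale ((- 1) ^ i * a powi (- int i) * q ^ (i * (d - i))) \<circ>
        primitive_idempotent X (racah_eigenvalue q d a i))"

end

end

theory Submission
  imports Defs
begin

text \<open>
  Everything is visible in the eigenbasis \<open>v\<close> of \<open>A\<close>, where \<open>W\<close> is diagonal with entries \<open>w\<^sub>i\<close>
  and \<open>B\<close>, \<open>C\<close> are tridiagonal. Conjugation by \<open>W\<close> multiplies the \<open>(i, j)\<close> entry of a matrix by
  the ratio \<open>s = w\<^sub>i / w\<^sub>j\<close> or its inverse. This does not change the diagonal, and a commutator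
  with \<open>A\<close> has zero diagonal, so only neighbours \<open>i\<close>, \<open>j\<close> matter. For these the weights of \<open>W\<close>
  are tuned to the eigenvalues of \<open>A\<close>:
  \<open>\<theta>\<^sub>i = - (q / s + s / q)\<close> and \<open>\<theta>\<^sub>j = - (q s + 1 / (q s))\<close> (lemma \<open>adjacent_eigenvalues\<close>). Two
  consequences follow.

  First, \<open>\<theta>\<^sub>i - \<theta>\<^sub>j = (q - 1 / q) (s - 1 / s)\<close>, so for tridiagonal \<open>T\<close> the
  commutator \<open>(A T - T A) / (q - 1 / q)\<close> equals the difference \<open>W T W\<^sup>-\<^sup>1 - W\<^sup>-\<^sup>1 T W\<close>. Second,
  \<open>\<theta>\<^sub>i / q - q \<theta>\<^sub>j = s (q\<^sup>2 - 1 / q\<^sup>2)\<close>, so the defining relation that expresses \<open>B\<close> by \<open>C A\<close> and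
  \<open>A C\<close> says, off the diagonal, just that the entry of \<open>B\<close> is \<open>s\<close> times the entry of \<open>C\<close>. Then each
  of the identities for \<open>W\<close> is an identity in \<open>s\<close> on neighbouring entries
  (theorem \<open>racah_W_conjugation\<close>). The data are invariant under the cyclic shift of \<open>(A, B, C)\<close>
  together with \<open>(a, b, c)\<close>, and this gives the identities for \<open>W'\<close> and \<open>W''\<close>.
\<close>

section \<open>Coordinates and diagonal operators\<close>

context leonard_space
begin

interpretation endo: vector_space_pair scale scale ..

definition coord :: "(nat \<Rightarrow> 'b) \<Rightarrow> 'b \<Rightarrow> nat \<Rightarrow> 'a" where
  "coord v x i = representation (v ` {..d}) x (v i)"

lemma coord_add: "ordered_basis v \<Longrightarrow> coord v (x + y) i = coord v x i + coord v y i"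
  by (simp add: coord_def ordered_basis_def representation_add)

lemma coord_diff: "ordered_basis v \<Longrightarrow> coord v (x - y) i = coord v x i - coord v y i"
  by (simp add: coord_def ordered_basis_def representation_diff)

lemma coord_scale: "ordered_basis v \<Longrightarrow> coord v (r *s x) i = r * coord v x i"
  by (simp add: coord_def ordered_basis_def representation_scale)

lemma coord_sum: "ordered_basis v \<Longrightarrow> coord v (sum f I) i = (\<Sum>k\<in>I. coord v (f k) i)"
  by (simp add: coord_def ordered_basis_def representation_sum)

lemma coord_zero: "coord v 0 i = 0"
  by (simp add: coord_def representation_zero)

lemma coord_basis:
  "ordered_basis v \<Longrightarrow> i \<le> d \<Longrightarrow> j \<le> d \<Longrightarrow> coord v (v j) i = (if i = j then 1 else 0)"
  by (auto simp: coord_def ordered_basis_def representation_basis inj_on_def)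

lemma sum_coord:
  assumes "ordered_basis v"
  shows "(\<Sum>i\<le>d. coord v x i *s v i) = x"
proof -
  have "(\<Sum>b\<in>v ` {..d}. representation (v ` {..d}) x b *s b) = x"
    using assms by (intro sum_representation_eq) (auto simp: ordered_basis_def)
  then show ?thesis
    using assms by (simp add: coord_def ordered_basis_def sum.reindex)
qed

lemma eq_by_coord:
  assumes "ordered_basis v" "\<And>i. i \<le> d \<Longrightarrow> coord v x i = coord v y i"
  shows "x = y"
  using sum_coord[OF assms(1), of x] sum_coord[OF assms(1), of y] assms(2)
  by (metis (no_types, lifting) atMost_iff sum.cong)

lemma linear_eq_on_basis:
  assumes "ordered_basis v" "Vector_Spaces.linear scale scale S" "Vector_Spaces.linear scale scale T"
    and "\<And>j. j \<le> d \<Longrightarrow> S (v j) = T (v j)"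
  shows "S = T"
proof
  fix x
  show "S x = T x"
    by (rule endo.linear_eq_on[OF assms(2,3), of _ "v ` {..d}"])
      (use assms(1,4) in \<open>auto simp: ordered_basis_def\<close>)
qed

lemma linear_eq_by_entries:
  assumes "ordered_basis v" "Vector_Spaces.linear scale scale S" "Vector_Spaces.linear scale scale T"
    and "\<And>i j. i \<le> d \<Longrightarrow> j \<le> d \<Longrightarrow> coord v (S (v j)) i = coord v (T (v j)) i"
  shows "S = T"
  using assms by (blast intro: linear_eq_on_basis eq_by_coord)

lemma matrix_of_entry:
  "i \<le> d \<Longrightarrow> j \<le> d \<Longrightarrow> matrix_of v T $$ (i, j) = coord v (T (v j)) i"
  by (simp add: matrix_of_def coord_def)

lemma linear_fun_add:
  "Vector_Spaces.linear scale scale S \<Longrightarrow> Vector_Spaces.linear scale scale T \<Longrightarrow> Vector_Spaces.linear scale scale (S + T)"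
  using endo.linear_compose_add[of S T] by (simp add: plus_fun_def)

lemma linear_fun_diff:
  "Vector_Spaces.linear scale scale S \<Longrightarrow> Vector_Spaces.linear scale scale T \<Longrightarrow> Vector_Spaces.linear scale scale (S - T)"
  using endo.linear_compose_sub[of S T] by (simp add: fun_diff_def)

lemma linear_fun_scale:
  "Vector_Spaces.linear scale scale T \<Longrightarrow> Vector_Spaces.linear scale scale (scale k \<circ> T)"
  using endo.linear_compose_scale_right[of T k] by (simp add: comp_def)

lemma linear_fun_compose:
  "Vector_Spaces.linear scale scale S \<Longrightarrow> Vector_Spaces.linear scale scale T \<Longrightarrow>
    Vector_Spaces.linear scale scale (S \<circ> T)"
  by (rule Vector_Spaces.linear_compose)

lemmas linear_fun_intros = linear_fun_add linear_fun_diff linear_fun_scale linear_fun_compose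

definition diagonal_on :: "(nat \<Rightarrow> 'b) \<Rightarrow> ('b \<Rightarrow> 'b) \<Rightarrow> (nat \<Rightarrow> 'a) \<Rightarrow> bool" where
  "diagonal_on v T \<delta> \<longleftrightarrow> Vector_Spaces.linear scale scale T \<and> (\<forall>i\<le>d. T (v i) = \<delta> i *s v i)"

lemma diagonal_on_exists:
  assumes "ordered_basis v"
  shows "\<exists>T. diagonal_on v T \<delta>"
proof -
  have inj: "inj_on v {..d}" and "independent (v ` {..d})"
    using assms by (auto simp: ordered_basis_def)
  then obtain T where "Vector_Spaces.linear scale scale T"
    and T: "\<forall>x\<in>v ` {..d}. T x = \<delta> (the_inv_into {..d} v x) *s x"
    using endo.linear_independent_extend
      [of "v ` {..d}" "\<lambda>x. \<delta> (the_inv_into {..d} v x) *s x"] by blast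
  moreover have "T (v i) = \<delta> i *s v i" if "i \<le> d" for i
    using T that inj by (simp add: the_inv_into_f_f)
  ultimately show ?thesis
    by (auto simp: diagonal_on_def)
qed

lemma coord_diagonal_on:
  assumes "ordered_basis v" "diagonal_on v T \<delta>" "i \<le> d"
  shows "coord v (T x) i = \<delta> i * coord v x i"
proof -
  have T: "Vector_Spaces.linear scale scale T" using assms(2) by (simp add: diagonal_on_def)
  have "T x = T (\<Sum>k\<le>d. coord v x k *s v k)"
    by (simp add: sum_coord assms(1))
  also have "\<dots> = (\<Sum>k\<le>d. (\<delta> k * coord v x k) *s v k)"
    using assms(2)
    by (simp add: endo.linear_sum[OF T] endo.linear_scale[OF T] diagonal_on_def mult.commute)
  finally have "coord v (T x) i = (\<Sum>k\<le>d. \<delta> k * coord v x k * (if i = k then 1 else 0))"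
    using assms(1,3) by (auto simp: coord_sum coord_scale coord_basis intro!: sum.cong)
  also have "\<dots> = \<delta> i * coord v x i"
    using assms(3) by (simp add: if_distrib cong: if_cong)
  finally show ?thesis .
qed

lemma diagonal_on_inverse:
  assumes v: "ordered_basis v" and T: "diagonal_on v T \<delta>"
    and nz: "\<And>i. i \<le> d \<Longrightarrow> \<delta> i \<noteq> 0"
  shows "diagonal_on v (inv T) (\<lambda>i. inverse (\<delta> i))"
proof -
  obtain U where U: "diagonal_on v U (\<lambda>i. inverse (\<delta> i))"
    using diagonal_on_exists[OF v] by blast
  have UT: "U (T x) = x" and TU: "T (U x) = x" for x
    by (rule eq_by_coord[OF v];
        simp add: coord_diagonal_on[OF v T] coord_diagonal_on[OF v U] nz)+
  then have "inv T = U" by (intro inv_equality) auto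
  with U show ?thesis by simp
qed

text \<open>
  Distinct eigenvalues force each eigenspace to be the line through one basis vector, so the
  projection is the diagonal operator with a single entry \<open>1\<close>.
\<close>

lemma primitive_idempotent_diagonal_on:
  assumes v: "ordered_basis v" and X: "diagonal_on v X \<theta>"
    and inj: "inj_on \<theta> {..d}" and i: "i \<le> d"
  shows "diagonal_on v (primitive_idempotent X (\<theta> i)) (\<lambda>j. if j = i then 1 else 0)"
proof -
  obtain E where E: "diagonal_on v E (\<lambda>j. if j = i then 1 else 0)"
    using diagonal_on_exists[OF v] by blast
  have eigen: "coord v x j = 0" if "x \<in> eigenspace X \<mu>" "j \<le> d" "\<theta> j \<noteq> \<mu>" for x j \<mu>
  proof -
    have "X x = \<mu> *s x" using that(1) by (simp add: eigenspace_def)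
    then have "\<theta> j * coord v x j = \<mu> * coord v x j"
      using coord_diagonal_on[OF v X that(2), of x] by (auto simp: coord_scale v)
    then show ?thesis using that(3) by simp
  qed
  have distinct: "\<theta> j \<noteq> \<theta> i" if "j \<le> d" "j \<noteq> i" for j
    using inj that i by (auto simp: inj_on_def)
  have fix_eigen: "E x = x" if "x \<in> eigenspace X (\<theta> i)" for x
    by (rule eq_by_coord[OF v]) (use that distinct eigen in \<open>auto simp: coord_diagonal_on[OF v E]\<close>)
  have "E x \<in> eigenspace X (\<theta> i)" for x
    unfolding eigenspace_def mem_Collect_eq
    by (rule eq_by_coord[OF v])
      (auto simp: coord_scale[OF v] coord_diagonal_on[OF v E] coord_diagonal_on[OF v X])
  with fix_eigen have range: "range E = eigenspace X (\<theta> i)"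
    by (metis image_subsetI rangeI subsetI subset_antisym)
  have kill: "E x = 0" if "x \<in> eigenspace X \<mu>" "\<mu> \<noteq> \<theta> i" for x \<mu>
    by (rule eq_by_coord[OF v])
      (use that i eigen in \<open>auto simp: coord_diagonal_on[OF v E] coord_zero\<close>)
  have basis_eigen: "v j \<in> eigenspace X (\<theta> j)" if "j \<le> d" for j
    using X that by (simp add: diagonal_on_def eigenspace_def)
  have "primitive_idempotent X (\<theta> i) = E"
    unfolding primitive_idempotent_def
  proof (rule the_equality)
    show "Vector_Spaces.linear scale scale E \<and> range E = eigenspace X (\<theta> i) \<and>
        (\<forall>x\<in>eigenspace X (\<theta> i). E x = x) \<and>
        (\<forall>\<mu>. \<mu> \<noteq> \<theta> i \<longrightarrow> (\<forall>x\<in>eigenspace X \<mu>. E x = 0))"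
      using E range fix_eigen kill by (auto simp: diagonal_on_def)
  next
    fix F
    assume F: "Vector_Spaces.linear scale scale F \<and> range F = eigenspace X (\<theta> i) \<and>
        (\<forall>x\<in>eigenspace X (\<theta> i). F x = x) \<and>
        (\<forall>\<mu>. \<mu> \<noteq> \<theta> i \<longrightarrow> (\<forall>x\<in>eigenspace X \<mu>. F x = 0))"
    have "F (v j) = E (v j)" if "j \<le> d" for j
      using F basis_eigen[OF that] fix_eigen kill distinct[OF that] by (cases "j = i") metis+
    then show "F = E"
      using F E by (intro linear_eq_on_basis[OF v]) (auto simp: diagonal_on_def)
  qed
  with E show ?thesis by simp
qed

end

section \<open>The eigenvalues of A and the weights of W\<close>

definition racah_weight :: "'a::field \<Rightarrow> nat \<Rightarrow> 'a \<Rightarrow> nat \<Rightarrow> 'a" where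
  "racah_weight q d a i = (- 1) ^ i * a powi (- int i) * q ^ (i * (d - i))"

lemma racah_weight_nonzero: "q \<noteq> 0 \<Longrightarrow> a \<noteq> 0 \<Longrightarrow> racah_weight q d a i \<noteq> 0"
  by (simp add: racah_weight_def)

text \<open>
  The exponent \<open>i (d - i)\<close> is quadratic in \<open>i\<close>, with difference \<open>d - 2 i - 1\<close>; hence the ratio of
  consecutive weights is a multiple of a summand of the eigenvalue.
\<close>

lemma racah_weight_Suc:
  fixes q a :: "'a::field"
  assumes "q \<noteq> 0" "a \<noteq> 0" "Suc i \<le> d"
  shows "racah_weight q d a (Suc i) =
    - inverse (q * (a * q powi (2 * int i - int d))) * racah_weight q d a i"
proof -
  have int_exp: "int (Suc i * (d - Suc i)) = - 1 - (2 * int i - int d) + int (i * (d - i))"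
    using le_Suc_ex[OF assms(3)] by (auto simp: algebra_simps)
  have "q ^ (Suc i * (d - Suc i)) = q powi (- 1 - (2 * int i - int d) + int (i * (d - i)))"
    by (simp only: power_int_of_nat [symmetric] int_exp)
  also have "\<dots> = inverse q * inverse (q powi (2 * int i - int d)) * q ^ (i * (d - i))"
    using assms(1)
    by (simp add: power_int_add power_int_diff power_int_minus divide_inverse del: of_nat_mult)
  finally have q_power: "q ^ (Suc i * (d - Suc i)) =
      inverse q * inverse (q powi (2 * int i - int d)) * q ^ (i * (d - i))" .
  have a_power: "a powi (- int (Suc i)) = inverse a * a powi (- int i)"
    using assms(2) by (simp add: power_int_minus del: of_nat_Suc)
  show ?thesis
    unfolding racah_weight_def q_power a_power by (simp add: mult_ac)
qed

lemma racah_eigenvalue_sum: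
  fixes q a :: "'a::field"
  assumes "u = a * q powi (2 * int i - int d)"
  shows "racah_eigenvalue q d a i = u + inverse u"
proof -
  have "int d - 2 * int i = - (2 * int i - int d)" by simp
  then show ?thesis
    unfolding racah_eigenvalue_def assms by (simp only: power_int_minus inverse_mult_distrib)
qed

text \<open>
  The formulas are symmetric under exchanging \<open>i\<close>, \<open>j\<close> and inverting \<open>s\<close>, so subdiagonal and
  superdiagonal entries can be treated alike.
\<close>

lemma adjacent_eigenvalues:
  fixes q a :: "'a::field"
  assumes "q \<noteq> 0" "a \<noteq> 0" "i \<le> d" "j \<le> d" "i = Suc j \<or> j = Suc i"
  defines "s \<equiv> racah_weight q d a i / racah_weight q d a j"
  shows "racah_eigenvalue q d a i = - (q / s + s / q)"
    and "racah_eigenvalue q d a j = - (q * s + 1 / (q * s))"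
proof -
  have step: "racah_eigenvalue q d a (Suc k) = - (q / t + t / q) \<and>
      racah_eigenvalue q d a k = - (q * t + 1 / (q * t))"
    if k: "Suc k \<le> d" and t: "t = racah_weight q d a (Suc k) / racah_weight q d a k" for k t
  proof -
    define u where "u = a * q powi (2 * int k - int d)"
    have u: "u \<noteq> 0" using assms(1,2) by (simp add: u_def)
    have t_u: "t = - inverse (q * u)"
      using racah_weight_nonzero[OF assms(1,2), of d k]
      by (simp add: t racah_weight_Suc[OF assms(1,2) k] u_def)
    have "q powi (2 * int (Suc k) - int d) = q powi (2 + (2 * int k - int d))"
      by (rule arg_cong[where f = "power_int q"]) simp
    also have "\<dots> = q\<^sup>2 * q powi (2 * int k - int d)"
      using assms(1) by (simp add: power_int_add)
    finally have "q\<^sup>2 * u = a * q powi (2 * int (Suc k) - int d)"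
      by (simp add: u_def mult_ac)
    then have "racah_eigenvalue q d a (Suc k) = q\<^sup>2 * u + inverse (q\<^sup>2 * u)"
      by (rule racah_eigenvalue_sum)
    moreover have "racah_eigenvalue q d a k = u + inverse u"
      using u_def by (rule racah_eigenvalue_sum)
    ultimately show ?thesis
      using assms(1) u by (simp add: t_u field_simps power2_eq_square)
  qed
  have "racah_eigenvalue q d a i = - (q / s + s / q) \<and>
      racah_eigenvalue q d a j = - (q * s + 1 / (q * s))"
    using assms(5)
  proof
    assume "i = Suc j"
    then show ?thesis using step[of j s] assms(3) by (simp add: s_def)
  next
    assume "j = Suc i"
    then have "racah_eigenvalue q d a j = - (q / inverse s + inverse s / q) \<and>
        racah_eigenvalue q d a i = - (q * inverse s + 1 / (q * inverse s))"
      using step[of i "inverse s"] assms(4) by (simp add: s_def)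
    then show ?thesis by (simp add: field_simps)
  qed
  then show "racah_eigenvalue q d a i = - (q / s + s / q)"
    and "racah_eigenvalue q d a j = - (q * s + 1 / (q * s))" by simp_all
qed

section \<open>Conjugation by W\<close>

context leonard_space
begin

interpretation endo: vector_space_pair scale scale ..

lemma racah_W_diagonal_on:
  assumes v: "ordered_basis v" and X: "diagonal_on v X (racah_eigenvalue q d a)"
    and inj: "inj_on (racah_eigenvalue q d a) {..d}"
  shows "diagonal_on v (racah_W q a X) (racah_weight q d a)"
proof -
  let ?E = "\<lambda>i. primitive_idempotent X (racah_eigenvalue q d a i)"
  have E: "diagonal_on v (?E i) (\<lambda>j. if j = i then 1 else 0)" if "i \<le> d" for i
    using primitive_idempotent_diagonal_on[OF v X inj that] .
  have sum_apply: "sum f I x = (\<Sum>i\<in>I. f i x)" for f :: "nat \<Rightarrow> 'b \<Rightarrow> 'b" and I x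
    by (induction I rule: infinite_finite_induct) auto
  have W: "racah_W q a X = (\<lambda>x. \<Sum>i\<le>d. racah_weight q d a i *s ?E i x)"
    by (rule ext) (simp add: racah_W_def racah_weight_def sum_apply)
  have "Vector_Spaces.linear scale scale (racah_W q a X)"
    unfolding W using E
    by (intro endo.linear_compose_sum ballI endo.linear_compose_scale_right)
      (auto simp: diagonal_on_def)
  moreover have "racah_W q a X (v j) = racah_weight q d a j *s v j" if "j \<le> d" for j
  proof -
    have "racah_W q a X (v j) =
        (\<Sum>i\<le>d. if j = i then racah_weight q d a j *s v j else 0)"
      unfolding W using E that by (intro sum.cong) (auto simp: diagonal_on_def)
    then show ?thesis using that by simp
  qed
  ultimately show ?thesis by (simp add: diagonal_on_def)
qed

theorem racah_W_conjugation:
  fixes q a \<alpha> :: 'a and X Y Z :: "'b \<Rightarrow> 'b"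
  assumes q: "q \<noteq> 0" "q ^ 4 \<noteq> 1" and a: "a \<noteq> 0"
    and lin: "Vector_Spaces.linear scale scale X" "Vector_Spaces.linear scale scale Y" "Vector_Spaces.linear scale scale Z"
    and std: "standard_ordering X Y Z (racah_eigenvalue q d a)"
    and rel: "racah_relation q Y Z X \<alpha>"
  defines "W \<equiv> racah_W q a X"
  shows "inv W \<circ> X \<circ> W = X" (is ?XW)
    and "inv W \<circ> Z \<circ> W =
      Y + (scale (1 / (q - inverse q)) \<circ> ((Z \<circ> X) - (X \<circ> Z))) - ((inv W \<circ> Y \<circ> W) - Z)" (is ?ZW)
    and "W \<circ> X \<circ> inv W = X" (is ?WX)
    and "W \<circ> Y \<circ> inv W =
      Z + (scale (1 / (q - inverse q)) \<circ> ((X \<circ> Y) - (Y \<circ> X))) + ((inv W \<circ> Y \<circ> W) - Z)" (is ?WY)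
    and "W \<circ> Z \<circ> inv W = Y - ((inv W \<circ> Y \<circ> W) - Z)" (is ?WZ)
proof -
  let ?\<theta> = "racah_eigenvalue q d a" and ?w = "racah_weight q d a"
  obtain v where inj: "inj_on ?\<theta> {..d}" and basis: "leonard_basis X Y Z v"
    and eigen: "\<forall>i\<le>d. v i \<in> eigenspace X (?\<theta> i)"
    using std by (auto simp: standard_ordering_def bij_betw_def)
  have v: "ordered_basis v" using basis by (simp add: leonard_basis_def)
  have X: "diagonal_on v X ?\<theta>"
    using lin(1) eigen by (simp add: diagonal_on_def eigenspace_def)
  have W: "diagonal_on v W ?w"
    unfolding W_def using racah_W_diagonal_on[OF v X inj] .
  have w_nz: "?w i \<noteq> 0" for i using racah_weight_nonzero[OF q(1) a] .
  have invW: "diagonal_on v (inv W) (\<lambda>i. inverse (?w i))"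
    using diagonal_on_inverse[OF v W w_nz] .
  have linW: "Vector_Spaces.linear scale scale W" "Vector_Spaces.linear scale scale (inv W)"
    using W invW by (auto simp: diagonal_on_def)
  have Xv: "X (v j) = ?\<theta> j *s v j" and Wv: "W (v j) = ?w j *s v j"
    and invWv: "inv W (v j) = inverse (?w j) *s v j" if "j \<le> d" for j
    using X W invW that by (auto simp: diagonal_on_def)
  note entry_simps = Xv Wv invWv endo.linear_scale[OF lin(1)] endo.linear_scale[OF lin(2)]
    endo.linear_scale[OF lin(3)] endo.linear_scale[OF linW(1)] endo.linear_scale[OF linW(2)]
    coord_add[OF v] coord_diff[OF v] coord_scale[OF v]
    coord_diagonal_on[OF v X] coord_diagonal_on[OF v W] coord_diagonal_on[OF v invW]

  define y where "y i j = coord v (Y (v j)) i" for i j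
  define z where "z i j = coord v (Z (v j)) i" for i j
  have far: "y i j = 0 \<and> z i j = 0" if "i \<le> d" "j \<le> d" "i \<noteq> j" "i \<noteq> Suc j" "j \<noteq> Suc i" for i j
  proof -
    have dims: "dim_row (matrix_of v T) = Suc d" for T by (simp add: matrix_of_def)
    have "tridiagonal_mat (matrix_of v Y)" "tridiagonal_mat (matrix_of v Z)"
      using basis by (auto simp: leonard_basis_def irreducible_tridiagonal_mat_def)
    then have "matrix_of v Y $$ (i, j) = 0" "matrix_of v Z $$ (i, j) = 0"
      using that unfolding tridiagonal_mat_def dims by (auto simp: less_Suc_eq_le)
    then show ?thesis using that by (simp add: y_def z_def matrix_of_entry)
  qed
  have q_nz: "q\<^sup>2 - inverse (q\<^sup>2) \<noteq> 0" "q - inverse q \<noteq> 0"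
  proof -
    have "q\<^sup>2 * (q\<^sup>2 - inverse (q\<^sup>2)) = q ^ 4 - 1"
      using q(1) by (simp add: field_simps flip: power_add)
    then show sq: "q\<^sup>2 - inverse (q\<^sup>2) \<noteq> 0" using q(2) by auto
    have "q\<^sup>2 - inverse (q\<^sup>2) = (q - inverse q) * (q + inverse q)"
      by (simp add: algebra_simps power2_eq_square)
    with sq show "q - inverse q \<noteq> 0" by auto
  qed
  have ratio: "y i j = ?w i / ?w j * z i j"
    and difference: "?\<theta> i - ?\<theta> j = (q - inverse q) * (?w i / ?w j - ?w j / ?w i)"
    if ij: "i \<le> d" "j \<le> d" "i = Suc j \<or> j = Suc i" for i j
  proof -
    define s where "s = ?w i / ?w j"
    have s: "s \<noteq> 0" "?w j / ?w i = 1 / s" using w_nz by (auto simp: s_def)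
    note \<theta> = adjacent_eigenvalues[OF q(1) a ij, folded s_def]
    have gap: "inverse q * ?\<theta> i - q * ?\<theta> j = s * (q\<^sup>2 - inverse (q\<^sup>2))"
      unfolding \<theta> using q(1) s by (simp add: field_simps power2_eq_square)
    have "coord v ((Y + (scale (1 / (q\<^sup>2 - q powi (-2))) \<circ>
            ((scale q \<circ> (Z \<circ> X)) - (scale (inverse q) \<circ> (X \<circ> Z))))) (v j)) i
        = coord v ((scale \<alpha> \<circ> id) (v j)) i"
      using rel by (simp add: racah_relation_def)
    moreover have "q powi (-2) = inverse (q\<^sup>2)" by (simp add: power_int_minus)
    ultimately have "y i j - (inverse q * ?\<theta> i - q * ?\<theta> j) / (q\<^sup>2 - inverse (q\<^sup>2)) * z i j = 0"
      using ij by (auto simp: entry_simps coord_basis[OF v] y_def z_def algebra_simps diff_divide_distrib)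
    then show "y i j = ?w i / ?w j * z i j"
      using q_nz(1) by (simp add: gap flip: s_def)
    show "?\<theta> i - ?\<theta> j = (q - inverse q) * (?w i / ?w j - ?w j / ?w i)"
      unfolding s(2) s_def[symmetric] \<theta> using q(1) s(1) by (simp add: field_simps)
  qed

  \<comment> \<open>All ratios are \<open>1\<close> on the diagonal, and the entries vanish outside the three central diagonals;
    only neighbours draw on the relation between \<open>Y\<close> and \<open>Z\<close>.\<close>
  have commutator: "(?\<theta> i - ?\<theta> j) / (q - inverse q) * y i j = (?w i / ?w j - ?w j / ?w i) * y i j"
    "(?\<theta> j - ?\<theta> i) / (q - inverse q) * z i j = (?w j / ?w i - ?w i / ?w j) * z i j"
    and swap: "?w i / ?w j * z i j + ?w j / ?w i * y i j = y i j + z i j"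
    if "i \<le> d" "j \<le> d" for i j
  proof -
    consider "i = j" | "i = Suc j \<or> j = Suc i" | "i \<noteq> j" "i \<noteq> Suc j" "j \<noteq> Suc i" by blast
    then have "(?\<theta> i - ?\<theta> j) / (q - inverse q) * y i j = (?w i / ?w j - ?w j / ?w i) * y i j \<and>
        (?\<theta> j - ?\<theta> i) / (q - inverse q) * z i j = (?w j / ?w i - ?w i / ?w j) * z i j \<and>
        ?w i / ?w j * z i j + ?w j / ?w i * y i j = y i j + z i j"
    proof cases
      case 1
      then show ?thesis using w_nz by simp
    next
      case 2
      have "?\<theta> j - ?\<theta> i = (q - inverse q) * (?w j / ?w i - ?w i / ?w j)"
        using difference[of j i] that 2 by blast
      then show ?thesis
        using difference[OF that 2] ratio[OF that 2] q_nz(2) w_nz by simp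
    next
      case 3
      then show ?thesis using far that by simp
    qed
    then show "(?\<theta> i - ?\<theta> j) / (q - inverse q) * y i j = (?w i / ?w j - ?w j / ?w i) * y i j"
      "(?\<theta> j - ?\<theta> i) / (q - inverse q) * z i j = (?w j / ?w i - ?w i / ?w j) * z i j"
      "?w i / ?w j * z i j + ?w j / ?w i * y i j = y i j + z i j" by blast+
  qed

  note entrywise = linear_eq_by_entries[OF v]
  show ?XW
    by (rule entrywise; (intro linear_fun_intros lin linW)?)
      (auto simp: entry_simps coord_basis[OF v] w_nz)
  show ?WX
    by (rule entrywise; (intro linear_fun_intros lin linW)?)
      (auto simp: entry_simps coord_basis[OF v] w_nz)
  show ?ZW
  proof (rule entrywise; (intro linear_fun_intros lin linW)?)
    fix i j assume ij: "i \<le> d" "j \<le> d"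
    have "?w j / ?w i * z i j =
        y i j + (?\<theta> j - ?\<theta> i) / (q - inverse q) * z i j - (?w j / ?w i * y i j - z i j)"
      unfolding commutator(2)[OF ij] using swap[OF ij] by (simp add: algebra_simps)
    then show "coord v ((inv W \<circ> Z \<circ> W) (v j)) i = coord v ((Y + (scale (1 / (q - inverse q)) \<circ>
        ((Z \<circ> X) - (X \<circ> Z))) - ((inv W \<circ> Y \<circ> W) - Z)) (v j)) i"
      using ij by (simp add: entry_simps y_def z_def algebra_simps divide_inverse)
  qed
  show ?WY
  proof (rule entrywise; (intro linear_fun_intros lin linW)?)
    fix i j assume ij: "i \<le> d" "j \<le> d"
    have "?w i / ?w j * y i j =
        z i j + (?\<theta> i - ?\<theta> j) / (q - inverse q) * y i j + (?w j / ?w i * y i j - z i j)"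
      unfolding commutator(1)[OF ij] by (simp add: algebra_simps)
    then show "coord v ((W \<circ> Y \<circ> inv W) (v j)) i = coord v ((Z + (scale (1 / (q - inverse q)) \<circ>
        ((X \<circ> Y) - (Y \<circ> X))) + ((inv W \<circ> Y \<circ> W) - Z)) (v j)) i"
      using ij by (simp add: entry_simps y_def z_def algebra_simps divide_inverse)
  qed
  show ?WZ
  proof (rule entrywise; (intro linear_fun_intros lin linW)?)
    fix i j assume ij: "i \<le> d" "j \<le> d"
    have "?w i / ?w j * z i j = y i j - (?w j / ?w i * y i j - z i j)"
      using swap[OF ij] by (simp add: algebra_simps)
    then show "coord v ((W \<circ> Z \<circ> inv W) (v j)) i =
        coord v ((Y - ((inv W \<circ> Y \<circ> W) - Z)) (v j)) i"
      using ij by (simp add: entry_simps y_def z_def algebra_simps divide_inverse)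
  qed
qed

end

section \<open>The three conjugations\<close>

theorem proposition9p2:
  fixes scale :: "'a::field \<Rightarrow> 'b::ab_group_add \<Rightarrow> 'b"
    and d :: nat
    and q a b c :: 'a
    and A B C W W' W'' Abar Bbar Cbar :: "'b \<Rightarrow> 'b"
  assumes V: "leonard_space scale d"
    and parameters: "racah_parameters q a b c d"
    and triple: "leonard_space.racah_leonard_triple scale d q a b c A B C"
    and W: "W = leonard_space.racah_W scale d q a A"
    and W': "W' = leonard_space.racah_W scale d q b B"
    and W'': "W'' = leonard_space.racah_W scale d q c C"
    and Abar: "Abar = (inv W \<circ> B \<circ> W) - C"
    and Bbar: "Bbar = (inv W' \<circ> C \<circ> W') - A"
    and Cbar: "Cbar = (inv W'' \<circ> A \<circ> W'') - B"
  shows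
    "inv W \<circ> A \<circ> W = A \<and>
     inv W \<circ> B \<circ> W = C + Abar \<and>
     inv W \<circ> C \<circ> W = B + (scale (1 / (q - inverse q)) \<circ> ((C \<circ> A) - (A \<circ> C))) - Abar \<and>
     W \<circ> A \<circ> inv W = A \<and>
     W \<circ> B \<circ> inv W = C + (scale (1 / (q - inverse q)) \<circ> ((A \<circ> B) - (B \<circ> A))) + Abar \<and>
     W \<circ> C \<circ> inv W = B - Abar \<and>

     inv W' \<circ> A \<circ> W' = C + (scale (1 / (q - inverse q)) \<circ> ((A \<circ> B) - (B \<circ> A))) - Bbar \<and>
     inv W' \<circ> B \<circ> W' = B \<and>
     inv W' \<circ> C \<circ> W' = A + Bbar \<and>
     W' \<circ> A \<circ> inv W' = C - Bbar \<and>
     W' \<circ> B \<circ> inv W' = B \<and>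
     W' \<circ> C \<circ> inv W' = A + (scale (1 / (q - inverse q)) \<circ> ((B \<circ> C) - (C \<circ> B))) + Bbar \<and>

     inv W'' \<circ> A \<circ> W'' = B + Cbar \<and>
     inv W'' \<circ> B \<circ> W'' = A + (scale (1 / (q - inverse q)) \<circ> ((B \<circ> C) - (C \<circ> B))) - Cbar \<and>
     inv W'' \<circ> C \<circ> W'' = C \<and>
     W'' \<circ> A \<circ> inv W'' = B + (scale (1 / (q - inverse q)) \<circ> ((C \<circ> A) - (A \<circ> C))) + Cbar \<and>
     W'' \<circ> B \<circ> inv W'' = A - Cbar \<and>
     W'' \<circ> C \<circ> inv W'' = C"
proof -
  interpret leonard_space scale d by (fact V)
  have q: "q \<noteq> 0" "q ^ 4 \<noteq> 1" and abc: "a \<noteq> 0" "b \<noteq> 0" "c \<noteq> 0"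
    using parameters by (auto simp: racah_parameters_def)
  have lin: "Vector_Spaces.linear scale scale A" "Vector_Spaces.linear scale scale B"
      "Vector_Spaces.linear scale scale C"
    and std: "standard_ordering A B C (racah_eigenvalue q d a)"
      "standard_ordering B C A (racah_eigenvalue q d b)"
      "standard_ordering C A B (racah_eigenvalue q d c)"
    and rel: "racah_relation q A B C (racah_alpha q d a b c)"
      "racah_relation q B C A (racah_alpha q d b c a)"
      "racah_relation q C A B (racah_alpha q d c a b)"
    using triple by (auto simp: racah_leonard_triple_def leonard_triple_def)
  note conj_W = racah_W_conjugation[OF q abc(1) lin(1,2,3) std(1) rel(2), folded W, folded Abar]
  note conj_W' = racah_W_conjugation[OF q abc(2) lin(2,3,1) std(2) rel(3), folded W', folded Bbar]
  note conj_W'' = racah_W_conjugation[OF q abc(3) lin(3,1,2) std(3) rel(1), folded W'', folded Cbar]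
  have "inv W \<circ> B \<circ> W = C + Abar" "inv W' \<circ> C \<circ> W' = A + Bbar" "inv W'' \<circ> A \<circ> W'' = B + Cbar"
    by (simp_all add: Abar Bbar Cbar)
  with conj_W conj_W' conj_W'' show ?thesis by blast
qed

end
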